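(* Let $\phi\in L^2(\mathbb{R})$ satisfy $0<C_\phi=\int_{\mathbb{R}}\frac{|\hat\phi(\omega)|^2}{|\omega|}\,d\omega<\infty$. (i) Let $p,q>1$ and $0<\rho<1$ with $\frac1p+\frac1q=1+\rho$, and let $\psi\in L^1(\mathbb{R})$, $\phi\in L^p(\mathbb{R})$, $\chi\in L^q(\mathbb{R})$. Then for all $u\neq v$ in $\mathbb{R}$, $$\int_{\mathbb{R}}|D^\alpha(u,v,w)|\,dw\le C_\phi^{-1}\,C(p,\rho)\,|u-v|^{-\rho}\,\|\psi\|_1\,\|\phi\|_p\,\|\chi\|_q ,$$ where $C(p,\rho)$ is a constant depending only on $p$ and $\rho$. (ii) Let $\rho\ge 1$, $\psi\in L^1(\mathbb{R})$, $(1+|y|^{\rho-1})\phi(y)\in L^1(\mathbb{R})$ and $(1+|y|^{\rho-1})\chi(y)\in L^1(\mathbb{R})$. Then for all $u\neq v$ in $\mathbb{R}$, $$\int_{\mathbb{R}}|D^\alpha(u,v,w)|\,dw\le C_\phi^{-1}\,2^{\rho-1}\,|u-v|^{-\rho}\Big[\big\|\phi(x)|x|^{\rho-1}\big\|_1\|\chi\|_1+\big\|\chi(y)|y|^{\rho-1}\big\|_1\|\phi\|_1\Big]\|\psi\|_1 .$$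
   Context: Let $\theta=\alpha\pi/2$ with $\sin\theta\ne 0$. For a function $f$ on $\mathbb{R}$ (with $f=\phi,\psi,\chi$), $a\in\mathbb{R}\setminus\{0\}$, $b\in\mathbb{R}$, put $$f^{\alpha}_{a,b}(t)=e^{-\frac{i}{2}(t^2-b^2)\cot\theta}\,|a|^{-\rho}\,f\!\left(\frac{t-b}{a}\right).$$ The basic function associated with $(\phi,\psi,\chi)$ is $$D^\alpha(u,v,w)=C_\phi^{-1}\int_{\mathbb{R}}\int_{\mathbb{R}}\overline{\psi^\alpha_{a,b}(w)}\;\overline{\chi^\alpha_{a,b}(v)}\;\phi^\alpha_{a,b}(u)\,|a|^{2\rho-3}\,da\,db .$$ The Fourier transform is $\hat\phi(\omega)=\int_{\mathbb{R}}\phi(t)e^{-i\omega t}\,dt$. *)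

theory Defs
  imports "HOL-Analysis.Analysis"
begin

text \<open>Functions on the real line are complex-valued; \<open>lebesgue\<close> is the complete Lebesgue measure.\<close>

definition in_Lp :: "real \<Rightarrow> (real \<Rightarrow> complex) \<Rightarrow> bool" where
  "in_Lp p f \<longleftrightarrow> f \<in> borel_measurable lebesgue \<and> integrable lebesgue (\<lambda>x. norm (f x) powr p)"

definition Lp_norm :: "real \<Rightarrow> (real \<Rightarrow> complex) \<Rightarrow> real" where
  "Lp_norm p f = (LINT x|lebesgue. norm (f x) powr p) powr (1 / p)"

text \<open>
  For \<open>f \<in> L\<^sup>2\<close> the integral \<open>\<integral> f(t) e\<^sup>-\<^sup>i\<^sup>\<omega>\<^sup>t dt\<close> need not converge absolutely, so the Fourier
  transform is the limit in \<open>L\<^sup>2\<close> of the integrals over \<open>[-n, n]\<close>. By Plancherel's theorem this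
  limit exists for every \<open>f \<in> L\<^sup>2\<close>. It is unique up to a null set, and it agrees almost everywhere
  with the absolutely convergent integral when also \<open>f \<in> L\<^sup>1\<close>.
\<close>

definition is_fourier_transform :: "(real \<Rightarrow> complex) \<Rightarrow> (real \<Rightarrow> complex) \<Rightarrow> bool" where
  "is_fourier_transform f g \<longleftrightarrow> in_Lp 2 g \<and>
     (\<lambda>n::nat. \<integral>\<^sup>+\<omega>. ennreal ((norm ((LINT t:{- real n..real n}|lebesgue.
          f t * exp (- (\<i> * complex_of_real (\<omega> * t)))) - g \<omega>))\<^sup>2) \<partial>lebesgue) \<longlonglongrightarrow> 0"

definition fourier :: "(real \<Rightarrow> complex) \<Rightarrow> real \<Rightarrow> complex" where
  "fourier f = (SOME g. is_fourier_transform f g)"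

text \<open>The integral is kept in \<open>ennreal\<close> so that its finiteness is a genuine condition.\<close>

definition adm_integral :: "(real \<Rightarrow> complex) \<Rightarrow> ennreal" where
  "adm_integral phi = (\<integral>\<^sup>+\<omega>. ennreal ((norm (fourier phi \<omega>))\<^sup>2 / \<bar>\<omega>\<bar>) \<partial>lebesgue)"

definition adm_const :: "(real \<Rightarrow> complex) \<Rightarrow> real" where
  "adm_const phi = enn2real (adm_integral phi)"

definition admissible :: "(real \<Rightarrow> complex) \<Rightarrow> bool" where
  "admissible phi \<longleftrightarrow> in_Lp 2 phi \<and> 0 < adm_integral phi \<and> adm_integral phi < \<infinity>"

definition frac_dilate ::
  "real \<Rightarrow> real \<Rightarrow> (real \<Rightarrow> complex) \<Rightarrow> real \<Rightarrow> real \<Rightarrow> real \<Rightarrow> complex" where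
  "frac_dilate \<alpha> \<rho> f a b t =
     exp (- (\<i> / 2) * complex_of_real ((t\<^sup>2 - b\<^sup>2) * cot (\<alpha> * pi / 2)))
       * complex_of_real (\<bar>a\<bar> powr (- \<rho>)) * f ((t - b) / a)"

definition basic_integrand ::
  "real \<Rightarrow> real \<Rightarrow> (real \<Rightarrow> complex) \<Rightarrow> (real \<Rightarrow> complex) \<Rightarrow> (real \<Rightarrow> complex) \<Rightarrow>
   real \<Rightarrow> real \<Rightarrow> real \<Rightarrow> real \<times> real \<Rightarrow> complex" where
  "basic_integrand \<alpha> \<rho> phi psi chi u v w = (\<lambda>(a, b).
     cnj (frac_dilate \<alpha> \<rho> psi a b w) * cnj (frac_dilate \<alpha> \<rho> chi a b v) * frac_dilate \<alpha> \<rho> phi a b u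
       * complex_of_real (\<bar>a\<bar> powr (2 * \<rho> - 3)))"

text \<open>
  The double integral is taken over \<open>\<real>\<^sup>2\<close>; the line \<open>a = 0\<close> is a null set. The library's integral
  is \<open>0\<close> where the integrand is not integrable, so statements about \<open>basic_fun\<close> have to assert
  integrability of \<open>basic_integrand\<close> separately.
\<close>

definition basic_fun ::
  "real \<Rightarrow> real \<Rightarrow> (real \<Rightarrow> complex) \<Rightarrow> (real \<Rightarrow> complex) \<Rightarrow> (real \<Rightarrow> complex) \<Rightarrow>
   real \<Rightarrow> real \<Rightarrow> real \<Rightarrow> complex" where
  "basic_fun \<alpha> \<rho> phi psi chi u v w =
     complex_of_real (inverse (adm_const phi))
       * (LINT z|lebesgue. basic_integrand \<alpha> \<rho> phi psi chi u v w z)"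

end

theory Submission
  imports Defs
begin

text \<open>
  Integrating out \<open>w\<close> produces \<open>\<bar>a\<bar> \<parallel>\<psi>\<parallel>\<^sub>1\<close>; the substitution \<open>y = (v - b) / a\<close>, \<open>s = (u - v) / a\<close> then turns
  the remaining double integral into
  \<open>\<bar>u - v\<bar>\<^sup>-\<^sup>\<rho> \<integral>\<integral> \<bar>\<chi>(y)\<bar> \<bar>\<phi>(y + s)\<bar> \<bar>s\<bar>\<^sup>\<rho>\<^sup>-\<^sup>1 ds dy\<close>. For \<open>\<rho> < 1\<close> this is bounded by the
  Hardy--Littlewood--Sobolev inequality, for \<open>\<rho> \<ge> 1\<close> by
  \<open>\<bar>x - y\<bar>\<^sup>\<rho>\<^sup>-\<^sup>1 \<le> 2\<^sup>\<rho>\<^sup>-\<^sup>1 (\<bar>x\<bar>\<^sup>\<rho>\<^sup>-\<^sup>1 + \<bar>y\<bar>\<^sup>\<rho>\<^sup>-\<^sup>1)\<close>.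

  The Hardy--Littlewood--Sobolev inequality is obtained from a pointwise estimate. Let
  \<open>F = \<bar>\<phi>\<bar>\<^sup>p\<close> and \<open>G = \<bar>\<chi>\<bar>\<^sup>q\<close> have integral 1. At distance \<open>r\<close> with \<open>F r \<ge> 1\<close>, Young's inequality
  bounds \<open>F\<^sup>1\<^sup>/\<^sup>p G\<^sup>1\<^sup>/\<^sup>q r\<^sup>\<rho>\<^sup>-\<^sup>1\<close> by \<open>F G + F \<sqdot> F (F r)\<^sup>-\<^sup>m\<close> with \<open>m > 1\<close>, and symmetrically if
  \<open>G r \<ge> 1\<close>; otherwise the larger of \<open>F\<close>, \<open>G\<close> replaces the smaller one. Every kernel
  \<open>A \<kappa>(A r)\<close> that appears has an integral in \<open>r\<close> independent of \<open>A\<close>.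
\<close>

section \<open>Tonelli, translations and the Haar measure of the multiplicative group\<close>

lemma nn_integral_lborel_Pair:
  fixes f :: "'a::euclidean_space \<times> 'b::euclidean_space \<Rightarrow> ennreal"
  assumes [measurable]: "f \<in> borel_measurable (borel \<Otimes>\<^sub>M borel)"
  shows "(\<integral>\<^sup>+z. f z \<partial>lborel) = (\<integral>\<^sup>+a. \<integral>\<^sup>+b. f (a, b) \<partial>lborel \<partial>lborel)"
proof -
  have "f \<in> borel_measurable (lborel \<Otimes>\<^sub>M lborel)" 
    using assms by simp
  then show ?thesis by (simp add: lborel.nn_integral_fst lborel_prod)
qed

lemma nn_integral_translate:
  fixes f :: "real \<Rightarrow> ennreal"
  assumes "f \<in> borel_measurable borel"
  shows "(\<integral>\<^sup>+x. f (t + x) \<partial>lborel) = (\<integral>\<^sup>+x. f x \<partial>lborel)"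
  using nn_integral_real_affine[OF assms, of 1 t] by simp

text \<open>The weight \<open>inverse \<bar>a\<bar>\<close> is the Haar density of the nonzero
  reals: the Jacobian \<open>\<bar>c\<bar>\<close> of the dilation cancels the factor picked up by
  the density.\<close>

lemma nn_integral_haar_dilate:
  fixes F :: "real \<Rightarrow> ennreal" and c :: real
  assumes [measurable]: "F \<in> borel_measurable borel" and c: "c \<noteq> 0"
  shows "(\<integral>\<^sup>+a. F (c * a) * ennreal (inverse \<bar>a\<bar>) \<partial>lborel)
       = (\<integral>\<^sup>+a. F a * ennreal (inverse \<bar>a\<bar>) \<partial>lborel)"
proof -
  have "(\<integral>\<^sup>+a. F a * ennreal (inverse \<bar>a\<bar>) \<partial>lborel)
      = \<bar>c\<bar> * (\<integral>\<^sup>+a. F (c * a) * ennreal (inverse \<bar>c * a\<bar>) \<partial>lborel)"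
    by (subst nn_integral_real_affine[OF _ c, of _ 0]) auto
  also have "\<dots> = (\<integral>\<^sup>+a. \<bar>c\<bar> * (F (c * a) * ennreal (inverse \<bar>c * a\<bar>)) \<partial>lborel)"
    by (rule nn_integral_cmult[symmetric]) measurable
  also have "\<dots> = (\<integral>\<^sup>+a. F (c * a) * ennreal (inverse \<bar>a\<bar>) \<partial>lborel)"
  proof (intro nn_integral_cong)
    fix a :: real
    have "ennreal \<bar>c\<bar> * ennreal (inverse \<bar>c * a\<bar>) = ennreal (inverse \<bar>a\<bar>)"
      using c by (simp add: ennreal_mult[symmetric] abs_mult)
    then show "\<bar>c\<bar> * (F (c * a) * ennreal (inverse \<bar>c * a\<bar>)) = F (c * a) * ennreal (inverse \<bar>a\<bar>)"
      by (metis mult.left_commute)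
  qed
  finally show ?thesis by simp
qed

text \<open>
  Unimodularity of the multiplicative group: for a test function \<open>k\<close> with positive finite integral,
  Tonelli and dilation invariance turn \<open>\<integral> k \<integral> F(1/b)\<close> into \<open>\<integral> k \<integral> F\<close>.
\<close>

lemma nn_integral_haar_inverse:
  fixes F :: "real \<Rightarrow> ennreal"
  assumes [measurable]: "F \<in> borel_measurable borel"
  shows "(\<integral>\<^sup>+a. F (inverse a) * ennreal (inverse \<bar>a\<bar>) \<partial>lborel)
       = (\<integral>\<^sup>+a. F a * ennreal (inverse \<bar>a\<bar>) \<partial>lborel)"
proof -
  define w where "w = (\<lambda>a::real. ennreal (inverse \<bar>a\<bar>))"
  have [measurable]: "w \<in> borel_measurable borel" unfolding w_def by measurable
  \<comment> \<open>On this interval the Haar density lies between 1/2 and 1, so \<open>?I k\<close>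
    is neither 0 nor \<open>top\<close> and can be cancelled in \<open>ennreal\<close> at the
    end.\<close>
  define k where "k = (indicator {1..2} :: real \<Rightarrow> ennreal)"
  have [measurable]: "k \<in> borel_measurable borel" unfolding k_def by measurable
  let ?I = "\<lambda>f. \<integral>\<^sup>+a. f a * w a \<partial>lborel"
  have dil: "?I (\<lambda>a. f (c * a)) = ?I f"
    if "f \<in> borel_measurable borel" "c \<noteq> 0" for f :: "real \<Rightarrow> ennreal" and c
    using nn_integral_haar_dilate[OF that] by (simp add: w_def)
  have dil_k: "?I (\<lambda>a. k (c * a)) = ?I k" and dil_F: "?I (\<lambda>a. F (c * a)) = ?I F"
    if "c \<noteq> 0" for c
    using that by (intro dil; measurable)+
  have k0: "?I k \<noteq> 0"
  proof
    assume "?I k = 0"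
    moreover have "(\<integral>\<^sup>+a. ennreal (1/2) * k a \<partial>lborel) \<le> ?I k"
    proof (intro nn_integral_mono)
      fix a :: real
      have "ennreal (1/2) \<le> w a" if "1 \<le> a" "a \<le> 2"
        unfolding w_def using that by (intro ennreal_leI) (simp add: field_simps)
      then show "ennreal (1/2) * k a \<le> k a * w a"
        by (cases "a \<in> {1..2}") (auto simp: k_def indicator_def)
    qed
    ultimately show False
      by (simp add: nn_integral_cmult k_def)
  qed
  have "?I k \<le> (\<integral>\<^sup>+a. k a \<partial>lborel)"
    unfolding k_def w_def
    by (intro nn_integral_mono) (auto simp: indicator_def field_simps)
  then have kfin: "?I k \<noteq> top" by (auto simp: k_def top_unique)
  have "?I k * ?I (\<lambda>b. F (inverse b)) = (\<integral>\<^sup>+b. ?I k * (F (inverse b) * w b) \<partial>lborel)"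
    by (rule nn_integral_cmult[symmetric]) measurable
  also have "\<dots> = (\<integral>\<^sup>+b. ?I (\<lambda>a. k (b * a)) * (F (inverse b) * w b) \<partial>lborel)"
  proof (intro nn_integral_cong)
    fix b :: real
    show "?I k * (F (inverse b) * w b) = ?I (\<lambda>a. k (b * a)) * (F (inverse b) * w b)"
    \<comment> \<open>Dilation invariance excludes the factor 0; there both sides vanish because
      \<open>inverse 0 = 0\<close> makes \<open>w 0 = 0\<close>.\<close>
    proof (cases "b = 0")
      case False
      show ?thesis unfolding dil_k[OF False] ..
    qed (simp add: w_def)
  qed
  also have "\<dots> = (\<integral>\<^sup>+b. \<integral>\<^sup>+a. k (b * a) * w a * (F (inverse b) * w b) \<partial>lborel \<partial>lborel)"
    by (intro nn_integral_cong nn_integral_multc[symmetric]) measurable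
  also have "\<dots> = (\<integral>\<^sup>+a. \<integral>\<^sup>+b. k (b * a) * w a * (F (inverse b) * w b) \<partial>lborel \<partial>lborel)"
    by (rule lborel_pair.Fubini') measurable
  also have "\<dots> = (\<integral>\<^sup>+a. w a * ?I (\<lambda>b. k (a * b) * F (inverse b)) \<partial>lborel)"
    by (subst nn_integral_cmult[symmetric]) (auto simp: mult_ac)
  also have "\<dots> = (\<integral>\<^sup>+a. w a * ?I (\<lambda>b. k b * F (a * inverse b)) \<partial>lborel)"
  proof (intro nn_integral_cong)
    fix a :: real
    show "w a * ?I (\<lambda>b. k (a * b) * F (inverse b)) = w a * ?I (\<lambda>b. k b * F (a * inverse b))"
    proof (cases "a = 0")
      case False
      \<comment> \<open>Reading \<open>F (inverse b)\<close> as
        \<open>F (a * inverse (a * b))\<close> makes the whole test integrand a function of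
        \<open>a * b\<close>, to which invariance in \<open>b\<close> applies.\<close>
      have "a * inverse (a * b) = inverse b" for b
        using False by (simp add: inverse_mult_distrib flip: mult.assoc)
      with dil[OF _ False, of "\<lambda>b. k b * F (a * inverse b)"] show ?thesis by (simp only:) measurable
    qed (simp add: w_def)
  qed
  also have "\<dots> = (\<integral>\<^sup>+a. \<integral>\<^sup>+b. w a * (k b * F (a * inverse b) * w b) \<partial>lborel \<partial>lborel)"
    by (intro nn_integral_cong nn_integral_cmult[symmetric]) measurable
  also have "\<dots> = (\<integral>\<^sup>+b. \<integral>\<^sup>+a. w a * (k b * F (a * inverse b) * w b) \<partial>lborel \<partial>lborel)"
    by (rule lborel_pair.Fubini') measurable
  also have "\<dots> = (\<integral>\<^sup>+b. k b * w b * ?I (\<lambda>a. F (inverse b * a)) \<partial>lborel)"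
    by (subst nn_integral_cmult[symmetric]) (auto simp: mult_ac)
  also have "\<dots> = (\<integral>\<^sup>+b. k b * w b * ?I F \<partial>lborel)"
  proof (intro nn_integral_cong)
    fix b :: real
    show "k b * w b * ?I (\<lambda>a. F (inverse b * a)) = k b * w b * ?I F"
      by (cases "b = 0") (simp_all add: dil_F, simp add: w_def)
  qed
  also have "\<dots> = ?I k * ?I F"
    by (rule nn_integral_multc) measurable
  finally show ?thesis
    using k0 kfin ennreal_mult_cancel_left unfolding w_def by blast
qed

section \<open>The kernel and the pointwise Hardy-Littlewood-Sobolev estimate\<close>

text \<open>This is the profile \<kappa> of the overview, evaluated only at nonnegative arguments.
  The first branch serves distances where both densities are small, the second is the tail produced
  by Young's inequality.\<close>

definition hls_kernel :: "real \<Rightarrow> real \<Rightarrow> real \<Rightarrow> real" where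
  "hls_kernel \<rho> m t = (if t < 1 then t powr (\<rho> - 1) else t powr (- m))"

lemma borel_measurable_hls_kernel [measurable]: "hls_kernel \<rho> m \<in> borel_measurable borel"
  unfolding hls_kernel_def[abs_def] by measurable

lemma hls_kernel_nonneg [simp]: "0 \<le> hls_kernel \<rho> m t"
  by (simp add: hls_kernel_def)

text \<open>The singularity at 0 is integrable because \<rho> > 0, the tail because m > 1; negative
  arguments follow by reflection.\<close>

lemma nn_integral_hls_kernel_finite:
  assumes "0 < \<rho>" "1 < m"
  shows "(\<integral>\<^sup>+t. ennreal (hls_kernel \<rho> m \<bar>t\<bar>) \<partial>lborel) < top"
proof -
  \<comment> \<open>A majorant supported on the half line; both summands count at
    \<open>t = 1\<close>, which is harmless for an upper bound.\<close>
  define K where "K = (\<lambda>t::real. ennreal (indicator {0..1} t * t powr (\<rho> - 1))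
      + ennreal (indicator {1..} t * t powr (- m)))"
  have [measurable]: "K \<in> borel_measurable borel" unfolding K_def by measurable
  have "(\<integral>\<^sup>+t. K t \<partial>lborel) = (\<integral>\<^sup>+t. ennreal (indicator {0..1} t * t powr (\<rho> - 1)) \<partial>lborel)
      + (\<integral>\<^sup>+t. ennreal (indicator {1..} t * t powr (- m)) \<partial>lborel)"
    unfolding K_def by (rule nn_integral_add) measurable
  also have "\<dots> = ennreal (1 powr (\<rho> - 1 + 1) / (\<rho> - 1 + 1)) + ennreal (- (1 powr (- m + 1)) / (- m + 1))"
    using nn_integral_has_integral_lebesgue[OF _ has_integral_powr_from_0[of "\<rho> - 1" 1]]
      nn_integral_has_integral_lebesgue[OF _ has_integral_powr_to_inf[of "- m" 1]] assms
    by simp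
  finally have fin: "(\<integral>\<^sup>+t. K t \<partial>lborel) < top" by (simp add: less_top)
  have refl: "(\<integral>\<^sup>+t. K t \<partial>lborel) = (\<integral>\<^sup>+t. K (- t) \<partial>lborel)"
    by (subst nn_integral_real_affine[where c="-1" and t=0]) auto
  have "(\<integral>\<^sup>+t. ennreal (hls_kernel \<rho> m \<bar>t\<bar>) \<partial>lborel) \<le> (\<integral>\<^sup>+t. K t + K (- t) \<partial>lborel)"
  proof (intro nn_integral_mono)
    fix t :: real
    have "ennreal (hls_kernel \<rho> m \<bar>t\<bar>) \<le> K \<bar>t\<bar>"
      by (auto simp: hls_kernel_def K_def indicator_def)
    also have "\<dots> \<le> K t + K (- t)"
      by (cases "t \<ge> 0") (auto intro: add_increasing add_increasing2)
    finally show "ennreal (hls_kernel \<rho> m \<bar>t\<bar>) \<le> K t + K (- t)" .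
  qed
  also have "\<dots> = (\<integral>\<^sup>+t. K t \<partial>lborel) + (\<integral>\<^sup>+t. K t \<partial>lborel)"
    by (subst nn_integral_add) (auto simp: refl)
  also have "\<dots> < top" using fin by simp
  finally show ?thesis .
qed

text \<open>With one factor \<open>A\<close> taken out, Young's inequality with the conjugate
  exponents \<open>q\<close> and \<open>q'\<close> is applied to \<open>B powr (1 / q)\<close> and
  the remaining factor \<open>b\<close>. The estimate is valid at every distance, but its last term
  has an integrable profile only where \<open>A * r\<close> is bounded below.\<close>

lemma powr_product_le_far:
  fixes A B r p q \<rho> :: real
  assumes pos: "0 < A" "0 < B" "0 < r" and q: "1 < q" and pq: "1 / p + 1 / q = 1 + \<rho>"
  shows "A powr (1 / p) * B powr (1 / q) * r powr (\<rho> - 1)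
    \<le> A * B + A * (A * (A * r) powr (- ((1 - \<rho>) * q / (q - 1))))"
proof -
  define q' where "q' = q / (q - 1)"
  have q': "1 < q'" "1 / q + 1 / q' = 1" using q by (auto simp: q'_def field_simps)
  define b where "b = A powr (1 / p - 1) * r powr (\<rho> - 1)"
  \<comment> \<open>The relation between \<open>p\<close>, \<open>q\<close> and \<rho> makes the
    exponent of \<open>A\<close> in \<open>b powr q'\<close> exceed that of \<open>r\<close> by
    exactly 1, so that \<open>b powr q'\<close> is \<open>A\<close> times a power of
    \<open>A * r\<close>.\<close>
  have e: "(1 / p - 1) * q' = 1 - (1 - \<rho>) * q / (q - 1)"
  proof -
    have "1 / p - 1 = \<rho> - 1 / q" using pq by simp
    then show ?thesis using q by (simp add: q'_def field_simps)
  qed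
  have bq: "b powr q' = A * (A * r) powr (- ((1 - \<rho>) * q / (q - 1)))"
  proof -
    have "b powr q' = A powr ((1 / p - 1) * q') * r powr ((\<rho> - 1) * q')"
      using pos by (simp add: b_def powr_mult powr_powr)
    also have "\<dots> = A * A powr (- ((1 - \<rho>) * q / (q - 1))) * r powr (- ((1 - \<rho>) * q / (q - 1)))"
    proof -
      have "A powr ((1 / p - 1) * q') = A powr (1 + - ((1 - \<rho>) * q / (q - 1)))"
        unfolding e by simp
      also have "\<dots> = A * A powr (- ((1 - \<rho>) * q / (q - 1)))"
        using pos by (subst powr_add) simp
      moreover have "(\<rho> - 1) * q' = - ((1 - \<rho>) * q / (q - 1))"
        using q by (simp add: q'_def field_simps)
      ultimately show ?thesis by metis
    qed
    finally show ?thesis using pos by (simp add: powr_mult)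
  qed
  have "B powr (1 / q) * b \<le> (B powr (1 / q)) powr q / q + b powr q' / q'"
    using q q' pos by (intro Youngs_inequality) (auto simp: b_def)
  \<comment> \<open>The Young weights \<open>1 / q\<close> and \<open>1 / q'\<close> are at most 1
    and are dropped.\<close>
  also have "\<dots> \<le> B + b powr q'"
  proof (intro add_mono)
    show "(B powr (1 / q)) powr q / q \<le> B"
      using q pos by (simp add: powr_powr field_simps)
    show "b powr q' / q' \<le> b powr q'"
      using q' by (simp add: field_simps mult_right_mono[of 1 q', simplified])
  qed
  finally have "A * (B powr (1 / q) * b) \<le> A * (B + b powr q')"
    using pos by (intro mult_left_mono) auto
  moreover have "A * (B powr (1 / q) * b) = A powr (1 / p) * B powr (1 / q) * r powr (\<rho> - 1)"
    using pos by (simp add: b_def powr_diff)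
  ultimately show ?thesis unfolding bq by (simp add: distrib_left)
qed

text \<open>In each regime a single group of summands suffices and the others are nonnegative. The
  kernel in \<open>A\<close> carries the exponent built from \<open>q\<close>, since Young's
  inequality pairs \<open>B powr (1 / q)\<close> with a power of \<open>A\<close>; the kernel in
  \<open>B\<close> carries the one built from \<open>p\<close>.\<close>

lemma powr_product_le_kernels:
  fixes A B r p q \<rho> :: real
  assumes nonneg: "0 \<le> A" "0 \<le> B" "0 \<le> r" and p: "1 < p" and q: "1 < q"
    and pq: "1 / p + 1 / q = 1 + \<rho>" and \<rho>: "0 < \<rho>" "\<rho> < 1"
  shows "A powr (1 / p) * B powr (1 / q) * r powr (\<rho> - 1)
    \<le> A * B + (A * (A * hls_kernel \<rho> ((1 - \<rho>) * q / (q - 1)) (A * r))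
        + B * (B * hls_kernel \<rho> ((1 - \<rho>) * p / (p - 1)) (B * r)))"
    (is "?L \<le> A * B + (?X + ?Y)")
proof (cases "A = 0 \<or> B = 0 \<or> r = 0")
  case True
  \<comment> \<open>For \<open>r = 0\<close> this rests on the convention that
    \<open>0 powr x = 0\<close>, also for negative \<open>x\<close>.\<close>
  then have "?L = 0" by auto
  moreover have "0 \<le> ?X" "0 \<le> ?Y" "0 \<le> A * B" using nonneg by auto
  ultimately show ?thesis by linarith
next
  case False
  then have pos: "0 < A" "0 < B" "0 < r" using nonneg by auto
  have XY: "0 \<le> ?X" "0 \<le> ?Y" "0 \<le> A * B" using pos by auto
  \<comment> \<open>Putting the larger density \<open>M\<close> in both places gives
    \<open>M powr (1 / p + 1 / q)\<close>, that is, \<open>M powr (1 + \<rho>)\<close>, which is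
    regrouped here into the inner branch of the kernel.\<close>
  have near: "M powr (1 + \<rho>) * r powr (\<rho> - 1) = M * (M * (M * r) powr (\<rho> - 1))" if "0 < M" for M
  proof -
    have "M powr (1 + \<rho>) = M powr (1 + 1 + (\<rho> - 1))" by simp
    also have "\<dots> = M * M * M powr (\<rho> - 1)"
      using that by (simp only: powr_add) simp
    finally show ?thesis using that pos by (simp add: powr_mult)
  qed
  consider "1 \<le> A * r" | "1 \<le> B * r" | "A * r < 1" "B * r < 1" "B \<le> A" | "A * r < 1" "B * r < 1" "A \<le> B"
    by linarith
  then show ?thesis
  proof cases
    case 1
    then show ?thesis
      using powr_product_le_far[OF pos q pq] XY by (simp add: hls_kernel_def)
  next
    case 2
    \<comment> \<open>The far estimate with \<open>A\<close>, \<open>B\<close> and \<open>p\<close>,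
      \<open>q\<close> interchanged.\<close>
    then show ?thesis
      using powr_product_le_far[OF pos(2,1,3) p, of q \<rho>] pq XY by (simp add: hls_kernel_def mult_ac add_ac)
  next
    case 3
    have "?L \<le> A powr (1 / p) * A powr (1 / q) * r powr (\<rho> - 1)"
      using pos q 3 by (intro mult_right_mono mult_left_mono powr_mono2) auto
    also have "\<dots> = ?X"
      using near[OF pos(1)] 3 pq by (simp add: powr_add[symmetric] hls_kernel_def)
    finally show ?thesis using XY by linarith
  next
    case 4
    have "?L \<le> B powr (1 / p) * B powr (1 / q) * r powr (\<rho> - 1)"
      using pos p 4 by (intro mult_right_mono powr_mono2) auto
    also have "\<dots> = ?Y"
      using near[OF pos(2)] 4 pq by (simp add: powr_add[symmetric] hls_kernel_def)
    finally show ?thesis using XY by linarith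
  qed
qed

section \<open>The change of variables in the triple integral\<close>

text \<open>Integrating over \<open>w\<close> and substituting for \<open>b\<close> each contribute
  a factor \<open>\<bar>a\<bar>\<close>, leaving \<open>\<bar>a\<bar> powr (- \<rho> - 1)\<close>.
  Inversion of \<open>a\<close> under the Haar measure and a dilation by \<open>u - v\<close> then
  give the weight \<open>\<bar>s\<bar> powr (\<rho> - 1)\<close> and the power of
  \<open>\<bar>u - v\<bar>\<close>.\<close>

lemma nn_integral_dilations_product:
  fixes f g h :: "real \<Rightarrow> ennreal" and u v \<rho> :: real
  assumes [measurable]: "f \<in> borel_measurable borel" "g \<in> borel_measurable borel" "h \<in> borel_measurable borel"
    and uv: "u \<noteq> v"
  shows "(\<integral>\<^sup>+w. \<integral>\<^sup>+z. ennreal (\<bar>fst z\<bar> powr (- \<rho> - 3)) * h ((w - snd z) / fst z)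
            * (g ((v - snd z) / fst z) * f ((u - snd z) / fst z)) \<partial>lborel \<partial>lborel)
    = ennreal (\<bar>u - v\<bar> powr (- \<rho>)) * (\<integral>\<^sup>+x. h x \<partial>lborel)
        * (\<integral>\<^sup>+y. \<integral>\<^sup>+s. g y * f (y + s) * ennreal (\<bar>s\<bar> powr (\<rho> - 1)) \<partial>lborel \<partial>lborel)"
proof -
  define d where "d = u - v"
  have d: "d \<noteq> 0" using uv by (simp add: d_def)
  define H where "H = (\<integral>\<^sup>+x. h x \<partial>lborel)"
  let ?P = "\<lambda>w a b. ennreal (\<bar>a\<bar> powr (- \<rho> - 3)) * h ((w - b) / a) * (g ((v - b) / a) * f ((u - b) / a))"
  have inner: "(\<integral>\<^sup>+b. \<integral>\<^sup>+w. ?P w a b \<partial>lborel \<partial>lborel)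
      = (\<integral>\<^sup>+y. H * (g y * (ennreal (\<bar>a\<bar> powr (- \<rho> - 1)) * f (y + d / a))) \<partial>lborel)" for a
  \<comment> \<open>At \<open>a = 0\<close> both sides vanish, as every power of 0 under
    \<open>powr\<close> is 0.\<close>
  proof (cases "a = 0")
    case False
    have "(\<integral>\<^sup>+b. \<integral>\<^sup>+w. ?P w a b \<partial>lborel \<partial>lborel)
        = (\<integral>\<^sup>+b. ennreal (\<bar>a\<bar> powr (- \<rho> - 3)) * (\<bar>a\<bar> * H) * (g ((v - b) / a) * f ((u - b) / a)) \<partial>lborel)"
    proof (intro nn_integral_cong)
      fix b
      have "(\<integral>\<^sup>+w. h ((w - b) / a) \<partial>lborel) = \<bar>a\<bar> * H"
        unfolding H_def using False by (subst nn_integral_real_affine[OF _ False, of _ b]) auto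
      then show "(\<integral>\<^sup>+w. ?P w a b \<partial>lborel)
        = ennreal (\<bar>a\<bar> powr (- \<rho> - 3)) * (\<bar>a\<bar> * H) * (g ((v - b) / a) * f ((u - b) / a))"
        by (simp add: nn_integral_cmult nn_integral_multc)
    qed
    \<comment> \<open>The substitution is \<open>b = v - a * y\<close>.\<close>
    also have "\<dots> = \<bar>- a\<bar> * (\<integral>\<^sup>+y. ennreal (\<bar>a\<bar> powr (- \<rho> - 3)) * (\<bar>a\<bar> * H)
        * (g ((v - (v + - a * y)) / a) * f ((u - (v + - a * y)) / a)) \<partial>lborel)"
      using False by (intro nn_integral_real_affine) auto
    also have "\<dots> = (\<integral>\<^sup>+y. \<bar>- a\<bar> * (ennreal (\<bar>a\<bar> powr (- \<rho> - 3)) * (\<bar>a\<bar> * H)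
        * (g ((v - (v + - a * y)) / a) * f ((u - (v + - a * y)) / a))) \<partial>lborel)"
      by (rule nn_integral_cmult[symmetric]) measurable
    also have "\<dots> = (\<integral>\<^sup>+y. H * (g y * (ennreal (\<bar>a\<bar> powr (- \<rho> - 1)) * f (y + d / a))) \<partial>lborel)"
    proof (intro nn_integral_cong)
      fix y
      have "\<bar>a\<bar> * (\<bar>a\<bar> powr (- \<rho> - 3) * \<bar>a\<bar>) = \<bar>a\<bar> powr (1 + (- \<rho> - 3) + 1)"
        using False by (simp only: powr_add) simp
      also have "1 + (- \<rho> - 3) + 1 = - \<rho> - 1" by simp
      finally have "ennreal (\<bar>a\<bar> powr (- \<rho> - 1)) = \<bar>- a\<bar> * (ennreal (\<bar>a\<bar> powr (- \<rho> - 3)) * \<bar>a\<bar>)"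
        by (simp add: ennreal_mult[symmetric])
      moreover have "(v - (v + - a * y)) / a = y" "(u - (v + - a * y)) / a = y + d / a"
        using False by (auto simp: d_def field_simps)
      ultimately show "\<bar>- a\<bar> * (ennreal (\<bar>a\<bar> powr (- \<rho> - 3)) * (\<bar>a\<bar> * H)
          * (g ((v - (v + - a * y)) / a) * f ((u - (v + - a * y)) / a)))
        = H * (g y * (ennreal (\<bar>a\<bar> powr (- \<rho> - 1)) * f (y + d / a)))"
        by (simp add: mult_ac)
    qed
    finally show ?thesis .
  qed simp
  \<comment> \<open>Since \<open>\<bar>a\<bar> powr (- \<rho> - 1)\<close> is
    \<open>\<bar>inverse a\<bar> powr \<rho>\<close> times the Haar density, the integrand is a
    function of \<open>inverse a\<close> against the Haar measure.\<close>
  have inv: "(\<integral>\<^sup>+a. ennreal (\<bar>a\<bar> powr (- \<rho> - 1)) * f (y + d / a) \<partial>lborel)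
      = ennreal (\<bar>d\<bar> powr (- \<rho>)) * (\<integral>\<^sup>+s. f (y + s) * ennreal (\<bar>s\<bar> powr (\<rho> - 1)) \<partial>lborel)" for y
  proof -
    have "(\<integral>\<^sup>+a. ennreal (\<bar>a\<bar> powr (- \<rho> - 1)) * f (y + d / a) \<partial>lborel)
        = (\<integral>\<^sup>+a. (ennreal (\<bar>inverse a\<bar> powr \<rho>) * f (y + d * inverse a)) * ennreal (inverse \<bar>a\<bar>) \<partial>lborel)"
    proof (intro nn_integral_cong)
      fix a :: real
      have "\<bar>a\<bar> powr (- \<rho> - 1) = \<bar>inverse a\<bar> powr \<rho> * inverse \<bar>a\<bar>"
        by (cases "a = 0") (auto simp: powr_diff powr_minus inverse_powr abs_inverse divide_inverse)
      then show "ennreal (\<bar>a\<bar> powr (- \<rho> - 1)) * f (y + d / a)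
          = (ennreal (\<bar>inverse a\<bar> powr \<rho>) * f (y + d * inverse a)) * ennreal (inverse \<bar>a\<bar>)"
        by (simp add: ennreal_mult divide_inverse mult_ac)
    qed
    also have "\<dots> = (\<integral>\<^sup>+a. (ennreal (\<bar>a\<bar> powr \<rho>) * f (y + d * a)) * ennreal (inverse \<bar>a\<bar>) \<partial>lborel)"
      by (rule nn_integral_haar_inverse) measurable
    also have "\<dots> = (\<integral>\<^sup>+a. ennreal (\<bar>d\<bar> powr (- \<rho>))
        * (\<bar>d\<bar> * (f (y + d * a) * ennreal (\<bar>d * a\<bar> powr (\<rho> - 1)))) \<partial>lborel)"
    proof (intro nn_integral_cong)
      fix a :: real
      have "\<bar>a\<bar> powr \<rho> * inverse \<bar>a\<bar> = \<bar>a\<bar> powr (\<rho> - 1)"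
        by (cases "a = 0") (auto simp: powr_diff divide_inverse)
      \<comment> \<open>This prepares the substitution \<open>s = d * a\<close>: the inner factor
        \<open>\<bar>d\<bar>\<close> is its Jacobian.\<close>
      also have "\<dots> = \<bar>d\<bar> powr (- \<rho>) * (\<bar>d\<bar> * \<bar>d * a\<bar> powr (\<rho> - 1))"
        using d by (auto simp: abs_mult powr_mult powr_minus powr_diff field_simps)
      finally have "ennreal (\<bar>a\<bar> powr \<rho>) * ennreal (inverse \<bar>a\<bar>)
          = ennreal (\<bar>d\<bar> powr (- \<rho>)) * (\<bar>d\<bar> * ennreal (\<bar>d * a\<bar> powr (\<rho> - 1)))"
        by (simp add: ennreal_mult[symmetric])
      then show "(ennreal (\<bar>a\<bar> powr \<rho>) * f (y + d * a)) * ennreal (inverse \<bar>a\<bar>)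
         = ennreal (\<bar>d\<bar> powr (- \<rho>)) * (\<bar>d\<bar> * (f (y + d * a) * ennreal (\<bar>d * a\<bar> powr (\<rho> - 1))))"
        by (metis mult.left_commute mult.commute)
    qed
    also have "\<dots> = ennreal (\<bar>d\<bar> powr (- \<rho>))
        * (\<bar>d\<bar> * (\<integral>\<^sup>+a. f (y + d * a) * ennreal (\<bar>d * a\<bar> powr (\<rho> - 1)) \<partial>lborel))"
      by (simp add: nn_integral_cmult)
    also have "\<bar>d\<bar> * (\<integral>\<^sup>+a. f (y + d * a) * ennreal (\<bar>d * a\<bar> powr (\<rho> - 1)) \<partial>lborel)
        = (\<integral>\<^sup>+s. f (y + s) * ennreal (\<bar>s\<bar> powr (\<rho> - 1)) \<partial>lborel)"
      by (subst (2) nn_integral_real_affine[OF _ d, of _ 0]) auto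
    finally show ?thesis .
  qed
  have "(\<integral>\<^sup>+w. \<integral>\<^sup>+z. ?P w (fst z) (snd z) \<partial>lborel \<partial>lborel)
      = (\<integral>\<^sup>+w. \<integral>\<^sup>+a. \<integral>\<^sup>+b. ?P w a b \<partial>lborel \<partial>lborel \<partial>lborel)"
    by (subst nn_integral_lborel_Pair) auto
  also have "\<dots> = (\<integral>\<^sup>+a. \<integral>\<^sup>+w. \<integral>\<^sup>+b. ?P w a b \<partial>lborel \<partial>lborel \<partial>lborel)"
    by (rule lborel_pair.Fubini') measurable
  also have "\<dots> = (\<integral>\<^sup>+a. \<integral>\<^sup>+b. \<integral>\<^sup>+w. ?P w a b \<partial>lborel \<partial>lborel \<partial>lborel)"
    by (rule nn_integral_cong, rule lborel_pair.Fubini') measurable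
  also have "\<dots> = (\<integral>\<^sup>+a. \<integral>\<^sup>+y. H * (g y * (ennreal (\<bar>a\<bar> powr (- \<rho> - 1)) * f (y + d / a))) \<partial>lborel \<partial>lborel)"
    unfolding inner ..
  \<comment> \<open>The order is exchanged so that the inversion of \<open>a\<close> takes place at
    fixed \<open>y\<close>.\<close>
  also have "\<dots> = (\<integral>\<^sup>+y. \<integral>\<^sup>+a. H * (g y * (ennreal (\<bar>a\<bar> powr (- \<rho> - 1)) * f (y + d / a))) \<partial>lborel \<partial>lborel)"
    by (rule lborel_pair.Fubini') measurable
  also have "\<dots> = (\<integral>\<^sup>+y. (ennreal (\<bar>d\<bar> powr (- \<rho>)) * H)
        * (g y * (\<integral>\<^sup>+s. f (y + s) * ennreal (\<bar>s\<bar> powr (\<rho> - 1)) \<partial>lborel)) \<partial>lborel)"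
  proof (rule nn_integral_cong)
    fix y
    have "(\<integral>\<^sup>+a. H * (g y * (ennreal (\<bar>a\<bar> powr (- \<rho> - 1)) * f (y + d / a))) \<partial>lborel)
        = H * (g y * (\<integral>\<^sup>+a. ennreal (\<bar>a\<bar> powr (- \<rho> - 1)) * f (y + d / a) \<partial>lborel))"
      by (simp add: nn_integral_cmult)
    then show "(\<integral>\<^sup>+a. H * (g y * (ennreal (\<bar>a\<bar> powr (- \<rho> - 1)) * f (y + d / a))) \<partial>lborel)
        = (ennreal (\<bar>d\<bar> powr (- \<rho>)) * H)
          * (g y * (\<integral>\<^sup>+s. f (y + s) * ennreal (\<bar>s\<bar> powr (\<rho> - 1)) \<partial>lborel))"
      unfolding inv by (simp only: mult_ac)
  qed
  also have "\<dots> = ennreal (\<bar>d\<bar> powr (- \<rho>)) * H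
        * (\<integral>\<^sup>+y. g y * (\<integral>\<^sup>+s. f (y + s) * ennreal (\<bar>s\<bar> powr (\<rho> - 1)) \<partial>lborel) \<partial>lborel)"
    by (rule nn_integral_cmult) measurable
  also have "(\<integral>\<^sup>+y. g y * (\<integral>\<^sup>+s. f (y + s) * ennreal (\<bar>s\<bar> powr (\<rho> - 1)) \<partial>lborel) \<partial>lborel)
      = (\<integral>\<^sup>+y. \<integral>\<^sup>+s. g y * f (y + s) * ennreal (\<bar>s\<bar> powr (\<rho> - 1)) \<partial>lborel \<partial>lborel)"
    by (simp add: nn_integral_cmult[symmetric] mult.assoc)
  finally show ?thesis unfolding H_def d_def .
qed

section \<open>The Hardy-Littlewood-Sobolev inequality\<close>

text \<open>The 1 comes from the product term of the pointwise estimate. Under the hypotheses of the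
  inequality both integrals are finite, so \<open>enn2real\<close> loses nothing.\<close>

definition hls_const :: "real \<Rightarrow> real \<Rightarrow> real \<Rightarrow> real" where
  "hls_const p q \<rho> = enn2real (1
      + ((\<integral>\<^sup>+t. ennreal (hls_kernel \<rho> ((1 - \<rho>) * q / (q - 1)) \<bar>t\<bar>) \<partial>lborel)
        + (\<integral>\<^sup>+t. ennreal (hls_kernel \<rho> ((1 - \<rho>) * p / (p - 1)) \<bar>t\<bar>) \<partial>lborel)))"

text \<open>The substitution \<open>t = A * s\<close> absorbs one factor \<open>A\<close>; the other
  remains as a density, to be integrated to 1 later.\<close>

lemma nn_integral_hls_kernel_scaled:
  assumes "0 \<le> A"
  shows "(\<integral>\<^sup>+s. ennreal (A * (A * hls_kernel \<rho> m (A * \<bar>s\<bar>))) \<partial>lborel)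
    = ennreal A * (\<integral>\<^sup>+t. ennreal (hls_kernel \<rho> m \<bar>t\<bar>) \<partial>lborel)"
proof (cases "A = 0")
  case False
  have "(\<integral>\<^sup>+t. ennreal (hls_kernel \<rho> m \<bar>t\<bar>) \<partial>lborel)
      = A * (\<integral>\<^sup>+s. ennreal (hls_kernel \<rho> m (A * \<bar>s\<bar>)) \<partial>lborel)"
    using assms False by (subst nn_integral_real_affine[OF _ False, of _ 0]) (auto simp: abs_mult)
  then show ?thesis
    using assms by (simp add: ennreal_mult nn_integral_cmult)
qed simp

text \<open>The pointwise estimate is integrated term by term; with unit masses each of the three
  terms has an explicit integral.\<close>

lemma hardy_littlewood_sobolev_normalized:
  fixes F G :: "real \<Rightarrow> real" and p q \<rho> :: real
  assumes [measurable]: "F \<in> borel_measurable borel" "G \<in> borel_measurable borel"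
    and nonneg: "\<And>x. 0 \<le> F x" "\<And>x. 0 \<le> G x"
    and one: "(\<integral>\<^sup>+x. ennreal (F x) \<partial>lborel) = 1" "(\<integral>\<^sup>+x. ennreal (G x) \<partial>lborel) = 1"
    and p: "1 < p" and q: "1 < q" and pq: "1 / p + 1 / q = 1 + \<rho>" and \<rho>: "0 < \<rho>" "\<rho> < 1"
  shows "(\<integral>\<^sup>+y. \<integral>\<^sup>+s. ennreal (F (y + s) powr (1 / p) * G y powr (1 / q) * \<bar>s\<bar> powr (\<rho> - 1)) \<partial>lborel \<partial>lborel)
    \<le> ennreal (hls_const p q \<rho>)"
proof -
  let ?m = "\<lambda>q. (1 - \<rho>) * q / (q - 1)"
  let ?J = "\<lambda>q. \<integral>\<^sup>+t. ennreal (hls_kernel \<rho> (?m q) \<bar>t\<bar>) \<partial>lborel"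
  let ?X = "\<lambda>x s. ennreal (F x * (F x * hls_kernel \<rho> (?m q) (F x * \<bar>s\<bar>)))"
  let ?Y = "\<lambda>y s. ennreal (G y * (G y * hls_kernel \<rho> (?m p) (G y * \<bar>s\<bar>)))"
  \<comment> \<open>The condition \<open>1 < ?m r\<close> amounts to \<open>\<rho> * r < 1\<close>,
    which holds for \<open>p\<close> and \<open>q\<close> because the reciprocal of the other
    exponent is below 1.\<close>
  have exponent: "1 < ?m r" if "1 < r" "1 / r > \<rho>" for r
    using that \<rho> by (simp add: field_simps)
  have "1 / p < 1" "1 / q < 1" using p q by auto
  then have "1 / p > \<rho>" "1 / q > \<rho>" using pq by linarith+
  then have fin: "?J q < top" "?J p < top"
    using nn_integral_hls_kernel_finite[OF \<rho>(1)] exponent p q by auto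
  have shift: "(\<integral>\<^sup>+x. f (x + t) \<partial>lborel) = (\<integral>\<^sup>+x. f x \<partial>lborel)"
    if "f \<in> borel_measurable borel" for f :: "real \<Rightarrow> ennreal" and t
    using nn_integral_translate[OF that, of t] by (simp add: add.commute)
  have 1: "(\<integral>\<^sup>+y. \<integral>\<^sup>+s. ennreal (F (y + s) * G y) \<partial>lborel \<partial>lborel) = 1"
  proof -
    have "(\<integral>\<^sup>+s. ennreal (F (y + s) * G y) \<partial>lborel) = ennreal (G y)" for y
      using shift[of "\<lambda>x. ennreal (F x)" y] nonneg one
      by (simp add: ennreal_mult nn_integral_multc add.commute)
    then show ?thesis using one by simp
  qed
  \<comment> \<open>Here \<open>F\<close> depends on \<open>s\<close> through \<open>y + s\<close>;
    translating \<open>y\<close> at fixed \<open>s\<close> removes this dependence, after which the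
    scaled kernel is integrated over \<open>s\<close>.\<close>
  have X: "(\<integral>\<^sup>+y. \<integral>\<^sup>+s. ?X (y + s) s \<partial>lborel \<partial>lborel) = ?J q"
  proof -
    have "(\<integral>\<^sup>+y. \<integral>\<^sup>+s. ?X (y + s) s \<partial>lborel \<partial>lborel) = (\<integral>\<^sup>+s. \<integral>\<^sup>+y. ?X (y + s) s \<partial>lborel \<partial>lborel)"
      by (rule lborel_pair.Fubini') measurable
    also have "\<dots> = (\<integral>\<^sup>+s. \<integral>\<^sup>+x. ?X x s \<partial>lborel \<partial>lborel)"
      by (intro nn_integral_cong shift) measurable
    also have "\<dots> = (\<integral>\<^sup>+x. \<integral>\<^sup>+s. ?X x s \<partial>lborel \<partial>lborel)"
      by (rule lborel_pair.Fubini') measurable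
    also have "\<dots> = ?J q"
      using one by (simp add: nn_integral_hls_kernel_scaled nonneg nn_integral_multc)
    finally show ?thesis .
  qed
  have Y: "(\<integral>\<^sup>+y. \<integral>\<^sup>+s. ?Y y s \<partial>lborel \<partial>lborel) = ?J p"
    using one by (simp add: nn_integral_hls_kernel_scaled nonneg nn_integral_multc)
  have "(\<integral>\<^sup>+y. \<integral>\<^sup>+s. ennreal (F (y + s) powr (1 / p) * G y powr (1 / q) * \<bar>s\<bar> powr (\<rho> - 1)) \<partial>lborel \<partial>lborel)
      \<le> (\<integral>\<^sup>+y. \<integral>\<^sup>+s. ennreal (F (y + s) * G y) + (?X (y + s) s + ?Y y s) \<partial>lborel \<partial>lborel)"
  proof (intro nn_integral_mono)
    fix y s
    show "ennreal (F (y + s) powr (1 / p) * G y powr (1 / q) * \<bar>s\<bar> powr (\<rho> - 1))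
      \<le> ennreal (F (y + s) * G y) + (?X (y + s) s + ?Y y s)"
      using ennreal_leI[OF powr_product_le_kernels[OF nonneg(1)[of "y + s"] nonneg(2)[of y] abs_ge_zero[of s] p q pq \<rho>]]
      by (simp add: nonneg)
  qed
  also have "\<dots> = 1 + (?J q + ?J p)"
    by (simp add: nn_integral_add 1 X Y)
  also have "\<dots> = ennreal (hls_const p q \<rho>)"
    unfolding hls_const_def using fin by (simp add: ennreal_enn2real less_top)
  finally show ?thesis .
qed

text \<open>Dividing the powers by their masses \<open>M\<close> and \<open>N\<close> reduces to the
  normalized case; if a mass is 0, the function vanishes almost everywhere and so does the double
  integral.\<close>

lemma hardy_littlewood_sobolev:
  fixes f g :: "real \<Rightarrow> real" and p q \<rho> M N :: real
  assumes [measurable]: "f \<in> borel_measurable borel" "g \<in> borel_measurable borel"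
    and nonneg: "\<And>x. 0 \<le> f x" "\<And>x. 0 \<le> g x"
    and M: "(\<integral>\<^sup>+x. ennreal (f x powr p) \<partial>lborel) = ennreal M" "0 \<le> M"
    and N: "(\<integral>\<^sup>+x. ennreal (g x powr q) \<partial>lborel) = ennreal N" "0 \<le> N"
    and p: "1 < p" and q: "1 < q" and pq: "1 / p + 1 / q = 1 + \<rho>" and \<rho>: "0 < \<rho>" "\<rho> < 1"
  shows "(\<integral>\<^sup>+y. \<integral>\<^sup>+s. ennreal (g y * f (y + s) * \<bar>s\<bar> powr (\<rho> - 1)) \<partial>lborel \<partial>lborel)
    \<le> ennreal (hls_const p q \<rho> * M powr (1 / p) * N powr (1 / q))"
proof -
  consider "M = 0" | "N = 0" | "0 < M" "0 < N" using M N by linarith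
  then show ?thesis
  proof cases
    case 1
    have "AE x in lborel. ennreal (f x powr p) = 0"
      using M 1 by (intro nn_integral_0_iff_AE[THEN iffD1]) auto
    then have ae: "AE x in lborel. f x = 0"
      by eventually_elim (use nonneg in auto)
    have "AE s in lborel. ennreal (g y * f (y + s) * \<bar>s\<bar> powr (\<rho> - 1)) = 0" for y
    proof -
      have "AE s in lborel. f (y + s) = 0"
        using AE_borel_affine[of 1 "\<lambda>x. f x = 0" y] ae by simp
      then show ?thesis by eventually_elim simp
    qed
    then have "(\<integral>\<^sup>+s. ennreal (g y * f (y + s) * \<bar>s\<bar> powr (\<rho> - 1)) \<partial>lborel) = 0" for y
      by (subst nn_integral_0_iff_AE) auto
    then show ?thesis by simp
  next
    case 2
    have "AE x in lborel. ennreal (g x powr q) = 0"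
      using N 2 by (intro nn_integral_0_iff_AE[THEN iffD1]) auto
    then have "AE x in lborel. g x = 0"
      by eventually_elim (use nonneg in auto)
    then have "(\<integral>\<^sup>+y. \<integral>\<^sup>+s. ennreal (g y * f (y + s) * \<bar>s\<bar> powr (\<rho> - 1)) \<partial>lborel \<partial>lborel) = 0"
      by (subst nn_integral_0_iff_AE) auto
    then show ?thesis by simp
  next
    case 3
    define F where "F = (\<lambda>x. f x powr p / M)"
    define G where "G = (\<lambda>x. g x powr q / N)"
    have [measurable]: "F \<in> borel_measurable borel" "G \<in> borel_measurable borel"
      unfolding F_def G_def by measurable
    have FG: "\<And>x. 0 \<le> F x" "\<And>x. 0 \<le> G x" using 3 by (auto simp: F_def G_def)
    have one: "(\<integral>\<^sup>+x. ennreal (F x) \<partial>lborel) = 1" "(\<integral>\<^sup>+x. ennreal (G x) \<partial>lborel) = 1"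
      using 3 M N by (auto simp: F_def G_def divide_ennreal[symmetric] nn_integral_divide)
    have f: "f x = M powr (1 / p) * F x powr (1 / p)" for x
      using 3 p nonneg by (simp add: F_def powr_mult[symmetric] powr_powr)
    have g: "g x = N powr (1 / q) * G x powr (1 / q)" for x
      using 3 q nonneg by (simp add: G_def powr_mult[symmetric] powr_powr)
    have "(\<integral>\<^sup>+y. \<integral>\<^sup>+s. ennreal (g y * f (y + s) * \<bar>s\<bar> powr (\<rho> - 1)) \<partial>lborel \<partial>lborel)
        = (\<integral>\<^sup>+y. \<integral>\<^sup>+s. ennreal (M powr (1 / p) * N powr (1 / q))
            * ennreal (F (y + s) powr (1 / p) * G y powr (1 / q) * \<bar>s\<bar> powr (\<rho> - 1)) \<partial>lborel \<partial>lborel)"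
      by (intro nn_integral_cong) (simp add: f g ennreal_mult[symmetric] mult_ac)
    also have "\<dots> = ennreal (M powr (1 / p) * N powr (1 / q)) * (\<integral>\<^sup>+y. \<integral>\<^sup>+s.
            ennreal (F (y + s) powr (1 / p) * G y powr (1 / q) * \<bar>s\<bar> powr (\<rho> - 1)) \<partial>lborel \<partial>lborel)"
      by (simp add: nn_integral_cmult)
    also have "\<dots> \<le> ennreal (M powr (1 / p) * N powr (1 / q)) * ennreal (hls_const p q \<rho>)"
      using hardy_littlewood_sobolev_normalized[OF _ _ FG one p q pq \<rho>] by (intro mult_left_mono) auto
    also have "\<dots> = ennreal (hls_const p q \<rho> * M powr (1 / p) * N powr (1 / q))"
      by (simp add: ennreal_mult[symmetric] hls_const_def mult_ac)
    finally show ?thesis .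
  qed
qed

section \<open>The weighted estimate for \<rho> at least 1\<close>

text \<open>The distance is at most twice the larger modulus, the power is monotone, and the power
  of a maximum is one of the two summands.\<close>

lemma abs_diff_powr_le:
  fixes x y \<rho> :: real
  assumes "1 \<le> \<rho>"
  shows "\<bar>x - y\<bar> powr (\<rho> - 1) \<le> 2 powr (\<rho> - 1) * (\<bar>x\<bar> powr (\<rho> - 1) + \<bar>y\<bar> powr (\<rho> - 1))"
proof (cases "x = y")
  case False
  define m where "m = max \<bar>x\<bar> \<bar>y\<bar>"
  have "\<bar>x - y\<bar> powr (\<rho> - 1) \<le> (2 * m) powr (\<rho> - 1)"
    using assms by (intro powr_mono2) (auto simp: m_def)
  also have "\<dots> = 2 powr (\<rho> - 1) * m powr (\<rho> - 1)"
    by (simp add: powr_mult m_def)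
  also have "\<dots> \<le> 2 powr (\<rho> - 1) * (\<bar>x\<bar> powr (\<rho> - 1) + \<bar>y\<bar> powr (\<rho> - 1))"
    by (intro mult_left_mono) (auto simp: m_def max_def)
  finally show ?thesis .
qed simp

lemma nn_integral_weighted_L1_bound:
  fixes f g :: "real \<Rightarrow> real" and \<rho> :: real
  assumes [measurable]: "f \<in> borel_measurable borel" "g \<in> borel_measurable borel"
    and nonneg: "\<And>x. 0 \<le> f x" "\<And>x. 0 \<le> g x" and \<rho>: "1 \<le> \<rho>"
  shows "(\<integral>\<^sup>+y. \<integral>\<^sup>+s. ennreal (g y * f (y + s) * \<bar>s\<bar> powr (\<rho> - 1)) \<partial>lborel \<partial>lborel)
    \<le> ennreal (2 powr (\<rho> - 1)) *
      ((\<integral>\<^sup>+x. ennreal (f x * \<bar>x\<bar> powr (\<rho> - 1)) \<partial>lborel) * (\<integral>\<^sup>+y. ennreal (g y) \<partial>lborel)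
       + (\<integral>\<^sup>+y. ennreal (g y * \<bar>y\<bar> powr (\<rho> - 1)) \<partial>lborel) * (\<integral>\<^sup>+x. ennreal (f x) \<partial>lborel))"
proof -
  let ?c = "2 powr (\<rho> - 1)"
  have "(\<integral>\<^sup>+y. \<integral>\<^sup>+s. ennreal (g y * f (y + s) * \<bar>s\<bar> powr (\<rho> - 1)) \<partial>lborel \<partial>lborel)
      \<le> (\<integral>\<^sup>+y. \<integral>\<^sup>+s. ennreal ?c * (ennreal (f (y + s) * \<bar>y + s\<bar> powr (\<rho> - 1)) * ennreal (g y)
          + ennreal (g y * \<bar>y\<bar> powr (\<rho> - 1)) * ennreal (f (y + s))) \<partial>lborel \<partial>lborel)"
  proof (intro nn_integral_mono)
    fix y s
    \<comment> \<open>Here \<open>s\<close> is read as the difference of \<open>y + s\<close> and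
      \<open>y\<close>; the translation \<open>x = y + s\<close> then separates the
      variables.\<close>
    have "g y * f (y + s) * \<bar>s\<bar> powr (\<rho> - 1)
        \<le> g y * f (y + s) * (?c * (\<bar>y + s\<bar> powr (\<rho> - 1) + \<bar>y\<bar> powr (\<rho> - 1)))"
      using abs_diff_powr_le[OF \<rho>, of "y + s" y] nonneg by (intro mult_left_mono) auto
    also have "\<dots> = ?c * (f (y + s) * \<bar>y + s\<bar> powr (\<rho> - 1) * g y + g y * \<bar>y\<bar> powr (\<rho> - 1) * f (y + s))"
      by (simp add: algebra_simps)
    finally show "ennreal (g y * f (y + s) * \<bar>s\<bar> powr (\<rho> - 1))
        \<le> ennreal ?c * (ennreal (f (y + s) * \<bar>y + s\<bar> powr (\<rho> - 1)) * ennreal (g y)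
          + ennreal (g y * \<bar>y\<bar> powr (\<rho> - 1)) * ennreal (f (y + s)))"
      using nonneg by (simp add: ennreal_mult[symmetric] ennreal_plus[symmetric] ennreal_leI del: ennreal_plus)
  qed
  also have "\<dots> = (\<integral>\<^sup>+y. \<integral>\<^sup>+x. ennreal ?c * (ennreal (f x * \<bar>x\<bar> powr (\<rho> - 1)) * ennreal (g y)
          + ennreal (g y * \<bar>y\<bar> powr (\<rho> - 1)) * ennreal (f x)) \<partial>lborel \<partial>lborel)"
  proof (rule nn_integral_cong)
    fix y
    show "(\<integral>\<^sup>+s. ennreal ?c * (ennreal (f (y + s) * \<bar>y + s\<bar> powr (\<rho> - 1)) * ennreal (g y)
          + ennreal (g y * \<bar>y\<bar> powr (\<rho> - 1)) * ennreal (f (y + s))) \<partial>lborel)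
        = (\<integral>\<^sup>+x. ennreal ?c * (ennreal (f x * \<bar>x\<bar> powr (\<rho> - 1)) * ennreal (g y)
          + ennreal (g y * \<bar>y\<bar> powr (\<rho> - 1)) * ennreal (f x)) \<partial>lborel)"
      by (rule nn_integral_translate[where f = "\<lambda>x. ennreal ?c
        * (ennreal (f x * \<bar>x\<bar> powr (\<rho> - 1)) * ennreal (g y) + ennreal (g y * \<bar>y\<bar> powr (\<rho> - 1)) * ennreal (f x))"])
        measurable
  qed
  also have "\<dots> = ennreal ?c *
      ((\<integral>\<^sup>+x. ennreal (f x * \<bar>x\<bar> powr (\<rho> - 1)) \<partial>lborel) * (\<integral>\<^sup>+y. ennreal (g y) \<partial>lborel)
       + (\<integral>\<^sup>+y. ennreal (g y * \<bar>y\<bar> powr (\<rho> - 1)) \<partial>lborel) * (\<integral>\<^sup>+x. ennreal (f x) \<partial>lborel))"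
    by (simp add: nn_integral_cmult nn_integral_add nn_integral_multc)
  finally show ?thesis .
qed

section \<open>Borel representatives and passage between \<open>lebesgue\<close> and
  \<open>lborel\<close>\<close>

text \<open>Composition with Borel maps preserves Borel measurability but not Lebesgue measurability
  in general, so the integrals are computed for Borel representatives, obtained from real and
  imaginary parts.\<close>

lemma ex_borel_AE_eq:
  fixes f :: "real \<Rightarrow> complex"
  assumes [measurable]: "f \<in> borel_measurable lebesgue"
  obtains f' where "f' \<in> borel_measurable borel" "AE x in lborel. f x = f' x"
proof -
  have "(\<lambda>x. Re (f x)) \<in> borel_measurable lebesgue" "(\<lambda>x. Im (f x)) \<in> borel_measurable lebesgue"
    by measurable
  then obtain a b where ab: "a \<in> borel_measurable lborel" "AE x in lborel. Re (f x) = a x"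
      "b \<in> borel_measurable lborel" "AE x in lborel. Im (f x) = b x"
    using completion_ex_borel_measurable_real by metis
  show thesis
  proof
    have [measurable]: "a \<in> borel_measurable borel" "b \<in> borel_measurable borel" using ab by auto
    show "(\<lambda>x. complex_of_real (a x) + \<i> * complex_of_real (b x)) \<in> borel_measurable borel"
      by measurable
    show "AE x in lborel. f x = complex_of_real (a x) + \<i> * complex_of_real (b x)"
      using ab(2,4) by eventually_elim (simp add: complex_eq_iff)
  qed
qed

text \<open>For fixed \<open>a \<noteq> 0\<close> the quotient is a nondegenerate affine map of
  \<open>b\<close>, which pulls null sets back to null sets; Tonelli then covers the plane.\<close>

lemma AE_lborel_affine_quotient:
  fixes P :: "real \<Rightarrow> bool" and t :: real
  assumes P: "AE x in lborel. P x"
  shows "AE z in lborel. P ((t - snd z) / fst z)"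
proof -
  \<comment> \<open>A Borel null set enclosing the exceptions makes the preimage in the plane
    measurable.\<close>
  obtain N where N: "{x. \<not> P x} \<subseteq> N" "N \<in> null_sets lborel"
    using P by (auto simp: eventually_ae_filter)
  then have [measurable]: "N \<in> sets borel" by auto
  have "AE z in lborel \<Otimes>\<^sub>M lborel. (t - snd z) / fst z \<notin> N"
  proof (rule lborel_pair.AE_pair_measure)
    have "AE a in lborel. a \<noteq> (0::real)" by (rule AE_lborel_singleton)
    then show "AE a in lborel. AE b in lborel. (t - snd (a, b)) / fst (a, b) \<notin> N"
    proof eventually_elim
      case (elim a)
      have "AE x in lborel. x \<notin> N" using N(2) by (rule AE_not_in)
      then have "AE b in lborel. t / a + (- 1 / a) * b \<notin> N"
        using elim by (intro AE_borel_affine) auto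
      then show ?case
        by eventually_elim (use elim in \<open>simp add: field_simps\<close>)
    qed
  qed measurable
  then have "AE z in lborel. (t - snd z) / fst z \<notin> N" unfolding lborel_prod .
  then show ?thesis by eventually_elim (use N in auto)
qed

text \<open>The exceptional null set may depend on \<open>w\<close>, but no \<open>w\<close> is
  excluded, so a change of representatives leaves the integral in \<open>basic_fun\<close> unchanged
  at every point.\<close>

lemma basic_integrand_cong_AE:
  assumes "AE x in lborel. phi x = phi' x" "AE x in lborel. psi x = psi' x" "AE x in lborel. chi x = chi' x"
  shows "AE z in lborel. basic_integrand \<alpha> \<rho> phi psi chi u v w z = basic_integrand \<alpha> \<rho> phi' psi' chi' u v w z"
  using AE_lborel_affine_quotient[OF assms(1), of u] AE_lborel_affine_quotient[OF assms(2), of w]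
    AE_lborel_affine_quotient[OF assms(3), of v]
  by eventually_elim (simp add: basic_integrand_def frac_dilate_def split_beta)

lemma integrable_cong_AE_lebesgue:
  fixes f g :: "'a::euclidean_space \<Rightarrow> complex"
  assumes g: "g \<in> borel_measurable borel" and ae: "AE x in lborel. f x = g x"
  shows "integrable lebesgue f \<longleftrightarrow> integrable lborel g"
    and "(LINT x|lebesgue. f x) = (LINT x|lborel. g x)"
proof -
  have g': "g \<in> borel_measurable lebesgue" using g by (simp add: measurable_completion)
  have ae': "AE x in lebesgue. f x = g x" using ae by (rule AE_completion)
  \<comment> \<open>Completeness of \<open>lebesgue\<close> transfers measurability from
    \<open>g\<close> to \<open>f\<close>.\<close>
  then have f': "f \<in> borel_measurable lebesgue"
    using g' by (intro borel_measurable_AE[OF g']) auto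
  show "integrable lebesgue f \<longleftrightarrow> integrable lborel g"
    using integrable_cong_AE[OF f' g' ae'] integrable_completion[of g lborel] g by simp
  show "(LINT x|lebesgue. f x) = (LINT x|lborel. g x)"
    using integral_cong_AE[OF f' g' ae'] integral_completion[of g lborel] g by simp
qed

section \<open>Integrability and the bound for the basic function\<close>

lemma borel_measurable_basic_integrand [measurable]:
  assumes [measurable]: "phi \<in> borel_measurable borel" "psi \<in> borel_measurable borel" "chi \<in> borel_measurable borel"
  shows "(\<lambda>x. basic_integrand \<alpha> \<rho> phi psi chi u v (fst x) (snd x))
    \<in> borel_measurable (borel \<Otimes>\<^sub>M (borel \<Otimes>\<^sub>M borel))"
proof -
  have [measurable]: "cnj \<in> borel_measurable borel"
    by (intro borel_measurable_continuous_onI continuous_intros)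
  show ?thesis
    unfolding basic_integrand_def frac_dilate_def split_beta by measurable
qed

text \<open>The chirps have modulus 1, so \<alpha> disappears; three factors
  \<open>\<bar>a\<bar> powr (- \<rho>)\<close> and the weight
  \<open>\<bar>a\<bar> powr (2 * \<rho> - 3)\<close> combine.\<close>

lemma norm_basic_integrand:
  "norm (basic_integrand \<alpha> \<rho> phi psi chi u v w z)
    = \<bar>fst z\<bar> powr (- \<rho> - 3) * norm (psi ((w - snd z) / fst z))
        * (norm (chi ((v - snd z) / fst z)) * norm (phi ((u - snd z) / fst z)))"
proof -
  have "\<bar>a\<bar> powr (- \<rho> - 3) = \<bar>a\<bar> powr (- \<rho>) * \<bar>a\<bar> powr (- \<rho>) * \<bar>a\<bar> powr (- \<rho>) * \<bar>a\<bar> powr (2 * \<rho> - 3)" for a :: real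
    by (simp add: powr_add[symmetric])
  then show ?thesis
    by (simp add: basic_integrand_def frac_dilate_def split_beta norm_mult mult_ac)
qed

lemma nn_integral_norm_basic_integrand:
  assumes [measurable]: "phi \<in> borel_measurable borel" "psi \<in> borel_measurable borel" "chi \<in> borel_measurable borel"
    and "u \<noteq> v"
  shows "(\<integral>\<^sup>+w. \<integral>\<^sup>+z. ennreal (norm (basic_integrand \<alpha> \<rho> phi psi chi u v w z)) \<partial>lborel \<partial>lborel)
    = ennreal (\<bar>u - v\<bar> powr (- \<rho>)) * (\<integral>\<^sup>+x. ennreal (norm (psi x)) \<partial>lborel)
        * (\<integral>\<^sup>+y. \<integral>\<^sup>+s. ennreal (norm (chi y) * norm (phi (y + s)) * \<bar>s\<bar> powr (\<rho> - 1)) \<partial>lborel \<partial>lborel)"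
  using nn_integral_dilations_product[of "\<lambda>x. ennreal (norm (phi x))" "\<lambda>x. ennreal (norm (chi x))"
      "\<lambda>x. ennreal (norm (psi x))" u v \<rho>] \<open>u \<noteq> v\<close>
  by (simp add: norm_basic_integrand ennreal_mult)

text \<open>Finiteness of the triple integral of the norm gives joint integrability, from which
  Fubini yields integrable slices and an integrable function of \<open>w\<close>. Both ranges of
  \<rho> use this with their own \<open>K\<close>.\<close>

lemma basic_fun_bound:
  assumes phi: "AE x in lborel. phi x = phi' x" "phi' \<in> borel_measurable borel"
    and psi: "AE x in lborel. psi x = psi' x" "psi' \<in> borel_measurable borel"
    and chi: "AE x in lborel. chi x = chi' x" "chi' \<in> borel_measurable borel"
    and uv: "u \<noteq> v"
    and S: "(\<integral>\<^sup>+x. ennreal (norm (psi' x)) \<partial>lborel) = ennreal S" "0 \<le> S"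
    and K: "(\<integral>\<^sup>+y. \<integral>\<^sup>+s. ennreal (norm (chi' y) * norm (phi' (y + s)) * \<bar>s\<bar> powr (\<rho> - 1)) \<partial>lborel \<partial>lborel) \<le> ennreal K"
      "0 \<le> K"
  shows "AE w in lebesgue. integrable lebesgue (basic_integrand \<alpha> \<rho> phi psi chi u v w)"
    and "integrable lebesgue (\<lambda>w. basic_fun \<alpha> \<rho> phi psi chi u v w)"
    and "(LINT w|lebesgue. norm (basic_fun \<alpha> \<rho> phi psi chi u v w)) 
      \<le> inverse (adm_const phi) * (\<bar>u - v\<bar> powr (- \<rho>) * S * K)"
proof -
  define c where "c = inverse (adm_const phi)"
  note [measurable] = phi(2) psi(2) chi(2)
  let ?B = "\<lambda>w z. basic_integrand \<alpha> \<rho> phi' psi' chi' u v w z"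
  let ?E = "\<bar>u - v\<bar> powr (- \<rho>) * S * K"
  have c: "0 \<le> c" by (simp add: c_def adm_const_def)
  have meas_z: "?B w \<in> borel_measurable borel" for w
    using measurable_compose[OF measurable_Pair[OF measurable_const[of w] measurable_ident] borel_measurable_basic_integrand[OF phi(2) psi(2) chi(2)]]
    by (simp add: borel_prod)
  have meas: "(\<lambda>x. ?B (fst x) (snd x)) \<in> borel_measurable (lborel \<Otimes>\<^sub>M lborel)"
    using borel_measurable_basic_integrand[OF phi(2) psi(2) chi(2)] by (simp add: borel_prod lborel_prod)
  have bound: "(\<integral>\<^sup>+w. \<integral>\<^sup>+z. ennreal (norm (?B w z)) \<partial>lborel \<partial>lborel) \<le> ennreal ?E"
    using nn_integral_norm_basic_integrand[OF phi(2) psi(2) chi(2) uv, of \<alpha> \<rho>] S(2) K(2)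
      mult_left_mono[OF K(1), of "ennreal (\<bar>u - v\<bar> powr (- \<rho>)) * ennreal S"]
    by (simp add: S(1) ennreal_mult)
  have int: "integrable (lborel \<Otimes>\<^sub>M lborel) (\<lambda>x. ?B (fst x) (snd x))"
    unfolding integrable_iff_bounded
  proof
    have "(\<integral>\<^sup>+x. ennreal (norm (?B (fst x) (snd x))) \<partial>(lborel \<Otimes>\<^sub>M lborel))
        = (\<integral>\<^sup>+w. \<integral>\<^sup>+z. ennreal (norm (?B w z)) \<partial>lborel \<partial>lborel)"
      using meas by (subst lborel.nn_integral_fst[symmetric]) auto
    then show "(\<integral>\<^sup>+x. ennreal (norm (?B (fst x) (snd x))) \<partial>(lborel \<Otimes>\<^sub>M lborel)) < \<infinity>"
      using bound by (auto simp: less_top[symmetric] top_unique)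
  qed (rule meas)
  note eq = integrable_cong_AE_lebesgue[OF meas_z basic_integrand_cong_AE[OF phi(1) psi(1) chi(1)]]
  have AE: "AE w in lborel. integrable lborel (?B w)"
    using lborel_pair.AE_integrable_fst'[OF int] by simp
  then show "AE w in lebesgue. integrable lebesgue (basic_integrand \<alpha> \<rho> phi psi chi u v w)"
    by (intro AE_completion) (simp add: eq)
  let ?D = "\<lambda>w. complex_of_real c * (LINT z|lborel. ?B w z)"
  \<comment> \<open>Equality holds at every \<open>w\<close>: where the slice is not integrable,
    both integrals have the default value 0.\<close>
  have D: "basic_fun \<alpha> \<rho> phi psi chi u v = ?D"
    by (simp add: fun_eq_iff basic_fun_def eq c_def)
  have intD: "integrable lborel ?D"
    using lborel_pair.integrable_fst'[OF int] by simp
  then have [measurable]: "?D \<in> borel_measurable borel" by auto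
  show "integrable lebesgue (\<lambda>w. basic_fun \<alpha> \<rho> phi psi chi u v w)"
    unfolding D using intD by (simp add: integrable_completion)
  have "(LINT w|lebesgue. norm (basic_fun \<alpha> \<rho> phi psi chi u v w)) = (LINT w|lborel. norm (?D w))"
    unfolding D by (rule integral_completion) measurable
  moreover have "ennreal (LINT w|lborel. norm (?D w)) \<le> ennreal (c * ?E)"
  proof -
    have "ennreal (LINT w|lborel. norm (?D w)) = (\<integral>\<^sup>+w. ennreal (norm (?D w)) \<partial>lborel)"
      using intD by (intro nn_integral_eq_integral[symmetric]) auto
    also have "\<dots> \<le> (\<integral>\<^sup>+w. ennreal c * (\<integral>\<^sup>+z. ennreal (norm (?B w z)) \<partial>lborel) \<partial>lborel)"
    \<comment> \<open>The norm of the integral is compared with the integral of the norm only at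
      those \<open>w\<close> whose slice is integrable.\<close>
    proof (rule nn_integral_mono_AE)
      show "AE w in lborel. ennreal (norm (?D w)) \<le> ennreal c * (\<integral>\<^sup>+z. ennreal (norm (?B w z)) \<partial>lborel)"
        using AE
      proof eventually_elim
        case (elim w)
        show ?case
          using c mult_left_mono[OF integral_norm_bound_ennreal[OF elim], of "ennreal c"]
          by (simp add: norm_mult ennreal_mult)
      qed
    qed
    also have "\<dots> = ennreal c * (\<integral>\<^sup>+w. \<integral>\<^sup>+z. ennreal (norm (?B w z)) \<partial>lborel \<partial>lborel)"
      using meas by (intro nn_integral_cmult lborel.borel_measurable_nn_integral) (simp add: split_beta)
    also have "\<dots> \<le> ennreal c * ennreal ?E"
      by (intro mult_left_mono bound) simp
    finally show ?thesis using c S K by (simp add: ennreal_mult)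
  qed
  ultimately show "(LINT w|lebesgue. norm (basic_fun \<alpha> \<rho> phi psi chi u v w))
      \<le> inverse (adm_const phi) * ?E"
    using c S K by (simp add: ennreal_le_iff c_def)
qed

section \<open>Norms of representatives and weighted functions\<close>

lemma Lp_norm_nonneg [simp]: "0 \<le> Lp_norm p f"
  by (simp add: Lp_norm_def)

text \<open>This links the norms over \<open>lebesgue\<close> to Borel representatives over
  \<open>lborel\<close>, in the form of the masses \<open>M\<close> and \<open>N\<close>
  above.\<close>

lemma nn_integral_Lp_norm:
  assumes f: "in_Lp p f" and p: "0 < p" and ae: "AE x in lborel. f x = f' x"
    and [measurable]: "f' \<in> borel_measurable borel"
  shows "(\<integral>\<^sup>+x. ennreal (norm (f' x) powr p) \<partial>lborel) = ennreal (Lp_norm p f powr p)"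
proof -
  have "(\<integral>\<^sup>+x. ennreal (norm (f' x) powr p) \<partial>lborel) = (\<integral>\<^sup>+x. ennreal (norm (f x) powr p) \<partial>lborel)"
    by (intro nn_integral_cong_AE) (use ae in eventually_elim, simp)
  also have "\<dots> = (\<integral>\<^sup>+x. ennreal (norm (f x) powr p) \<partial>lebesgue)"
    by (simp add: nn_integral_completion)
  also have "\<dots> = ennreal (LINT x|lebesgue. norm (f x) powr p)"
    using f by (intro nn_integral_eq_integral) (auto simp: in_Lp_def)
  also have "\<dots> = ennreal (Lp_norm p f powr p)"
    using p by (simp add: Lp_norm_def powr_powr integral_nonneg_AE)
  finally show ?thesis .
qed

lemma in_Lp_1_mono:
  assumes "in_Lp 1 g" "f \<in> borel_measurable lebesgue" "\<And>x. norm (f x) \<le> norm (g x)"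
  shows "in_Lp 1 f"
  using assms by (auto simp: in_Lp_def intro: Bochner_Integration.integrable_bound)

text \<open>The weight \<open>1 + \<bar>y\<bar> powr r\<close> dominates both 1 and
  \<open>\<bar>y\<bar> powr r\<close>.\<close>

lemma in_Lp_1_weighted:
  assumes "in_Lp 1 (\<lambda>y. complex_of_real (1 + \<bar>y\<bar> powr r) * f y)"
  shows "in_Lp 1 f" and "in_Lp 1 (\<lambda>y. f y * complex_of_real (\<bar>y\<bar> powr r))"
proof -
  define W where "W y = complex_of_real (1 + \<bar>y\<bar> powr r)" for y :: real
  have [measurable]: "W \<in> borel_measurable lebesgue"
    unfolding W_def by (intro measurable_completion) measurable
  have [measurable]: "(\<lambda>y. complex_of_real (\<bar>y\<bar> powr r)) \<in> borel_measurable lebesgue"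
    by (intro measurable_completion) measurable
  have norm_W: "norm (W y) = 1 + \<bar>y\<bar> powr r" for y
    unfolding W_def norm_of_real by simp
  then have "W y \<noteq> 0" for y
    by (metis add_pos_nonneg norm_zero order_less_irrefl powr_ge_zero zero_less_one)
  \<comment> \<open>Measurability of \<open>f\<close> is recovered by dividing the weighted function
    by its nowhere vanishing weight.\<close>
  then have f: "f = (\<lambda>y. inverse (W y) * (W y * f y))" by (auto simp: field_simps)
  have [measurable]: "(\<lambda>y. W y * f y) \<in> borel_measurable lebesgue"
    using assms by (simp add: in_Lp_def W_def)
  have [measurable]: "f \<in> borel_measurable lebesgue" by (subst f) measurable
  have norm_Wf: "norm (complex_of_real (1 + \<bar>y\<bar> powr r) * f y) = norm (f y) + \<bar>y\<bar> powr r * norm (f y)" for y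
    by (simp only: norm_mult norm_W[unfolded W_def] distrib_right mult_1)
  show "in_Lp 1 f"
    by (rule in_Lp_1_mono[OF assms]) (simp_all only: norm_Wf, auto)
  show "in_Lp 1 (\<lambda>y. f y * complex_of_real (\<bar>y\<bar> powr r))"
    by (rule in_Lp_1_mono[OF assms]) (simp_all only: norm_Wf, auto simp: norm_mult mult.commute)
qed

section \<open>The two bounds for the basic function\<close>

theorem theorem3p2:
  shows "(\<exists>C :: real \<Rightarrow> real \<Rightarrow> real. \<forall>(\<alpha>::real) (p::real) (q::real) (\<rho>::real) phi psi chi.
      sin (\<alpha> * pi / 2) \<noteq> 0 \<and> admissible phi \<and>
      p > 1 \<and> q > 1 \<and> 0 < \<rho> \<and> \<rho> < 1 \<and> 1 / p + 1 / q = 1 + \<rho> \<and>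
      in_Lp 1 psi \<and> in_Lp p phi \<and> in_Lp q chi \<longrightarrow>
      (\<forall>u v. u \<noteq> v \<longrightarrow>
        (AE w in lebesgue. integrable lebesgue (basic_integrand \<alpha> \<rho> phi psi chi u v w)) \<and>
        integrable lebesgue (\<lambda>w. basic_fun \<alpha> \<rho> phi psi chi u v w) \<and>
        (LINT w|lebesgue. norm (basic_fun \<alpha> \<rho> phi psi chi u v w))
          \<le> inverse (adm_const phi) * C p \<rho> * \<bar>u - v\<bar> powr (- \<rho>)
              * Lp_norm 1 psi * Lp_norm p phi * Lp_norm q chi))
  \<and>
  (\<forall>(\<alpha>::real) (\<rho>::real) phi psi chi.
      sin (\<alpha> * pi / 2) \<noteq> 0 \<and> admissible phi \<and> \<rho> \<ge> 1 \<and>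
      in_Lp 1 psi \<and>
      in_Lp 1 (\<lambda>y. complex_of_real (1 + \<bar>y\<bar> powr (\<rho> - 1)) * phi y) \<and>
      in_Lp 1 (\<lambda>y. complex_of_real (1 + \<bar>y\<bar> powr (\<rho> - 1)) * chi y) \<longrightarrow>
      (\<forall>u v. u \<noteq> v \<longrightarrow>
        (AE w in lebesgue. integrable lebesgue (basic_integrand \<alpha> \<rho> phi psi chi u v w)) \<and>
        integrable lebesgue (\<lambda>w. basic_fun \<alpha> \<rho> phi psi chi u v w) \<and>
        (LINT w|lebesgue. norm (basic_fun \<alpha> \<rho> phi psi chi u v w))
          \<le> inverse (adm_const phi) * 2 powr (\<rho> - 1) * \<bar>u - v\<bar> powr (- \<rho>)
              * (Lp_norm 1 (\<lambda>x. phi x * complex_of_real (\<bar>x\<bar> powr (\<rho> - 1))) * Lp_norm 1 chi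
                 + Lp_norm 1 (\<lambda>y. chi y * complex_of_real (\<bar>y\<bar> powr (\<rho> - 1))) * Lp_norm 1 phi)
              * Lp_norm 1 psi))"
proof (rule conjI)
  \<comment> \<open>Solving the exponent relation for \<open>q\<close> turns
    \<open>hls_const p q \<rho>\<close> into a function of \<open>p\<close> and \<rho>
    alone.\<close>
  let ?C = "\<lambda>p \<rho>. hls_const p (1 / (1 + \<rho> - 1 / p)) \<rho>"
  have *: "(AE w in lebesgue. integrable lebesgue (basic_integrand \<alpha> \<rho> phi psi chi u v w)) \<and>
        integrable lebesgue (\<lambda>w. basic_fun \<alpha> \<rho> phi psi chi u v w) \<and>
        (LINT w|lebesgue. norm (basic_fun \<alpha> \<rho> phi psi chi u v w))
          \<le> inverse (adm_const phi) * ?C p \<rho> * \<bar>u - v\<bar> powr (- \<rho>)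
              * Lp_norm 1 psi * Lp_norm p phi * Lp_norm q chi"
    if p: "1 < p" and q: "1 < q" and \<rho>: "0 < \<rho>" "\<rho> < 1" and pq: "1 / p + 1 / q = 1 + \<rho>"
      and psi: "in_Lp 1 psi" and phi: "in_Lp p phi" and chi: "in_Lp q chi" and uv: "u \<noteq> v"
    for \<alpha> p q \<rho> :: real and phi psi chi u v
  proof -
    have q_eq: "1 / (1 + \<rho> - 1 / p) = q"
    proof -
      have "1 + \<rho> - 1 / p = 1 / q" using pq by simp
      then show ?thesis by simp
    qed
    obtain phi' where phi': "phi' \<in> borel_measurable borel" "AE x in lborel. phi x = phi' x"
      using phi ex_borel_AE_eq by (auto simp: in_Lp_def)
    obtain psi' where psi': "psi' \<in> borel_measurable borel" "AE x in lborel. psi x = psi' x"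
      using psi ex_borel_AE_eq by (auto simp: in_Lp_def)
    obtain chi' where chi': "chi' \<in> borel_measurable borel" "AE x in lborel. chi x = chi' x"
      using chi ex_borel_AE_eq by (auto simp: in_Lp_def)
    note [measurable] = phi'(1) psi'(1) chi'(1)
    let ?K = "hls_const p q \<rho> * Lp_norm p phi * Lp_norm q chi"
    have S: "(\<integral>\<^sup>+x. ennreal (norm (psi' x)) \<partial>lborel) = ennreal (Lp_norm 1 psi)"
      using nn_integral_Lp_norm[OF psi _ psi'(2,1)] by simp
    have K: "(\<integral>\<^sup>+y. \<integral>\<^sup>+s. ennreal (norm (chi' y) * norm (phi' (y + s)) * \<bar>s\<bar> powr (\<rho> - 1)) \<partial>lborel \<partial>lborel)
        \<le> ennreal ?K"
      \<comment> \<open>The masses are \<open>Lp_norm p phi powr p\<close> and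
        \<open>Lp_norm q chi powr q\<close>, whose roots are the norms themselves.\<close>
      using hardy_littlewood_sobolev[OF _ _ _ _ nn_integral_Lp_norm[OF phi _ phi'(2,1)] _
          nn_integral_Lp_norm[OF chi _ chi'(2,1)] _ p q pq \<rho>] p q
      by (simp add: powr_powr)
    have "0 \<le> ?K" by (simp add: hls_const_def)
    note bf = basic_fun_bound[OF phi'(2,1) psi'(2,1) chi'(2,1) uv S Lp_norm_nonneg K this, of \<alpha>]
    show ?thesis using bf unfolding q_eq by (simp add: mult_ac)
  qed
  show "\<exists>C :: real \<Rightarrow> real \<Rightarrow> real. \<forall>(\<alpha>::real) (p::real) (q::real) (\<rho>::real) phi psi chi.
      sin (\<alpha> * pi / 2) \<noteq> 0 \<and> admissible phi \<and>
      p > 1 \<and> q > 1 \<and> 0 < \<rho> \<and> \<rho> < 1 \<and> 1 / p + 1 / q = 1 + \<rho> \<and>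
      in_Lp 1 psi \<and> in_Lp p phi \<and> in_Lp q chi \<longrightarrow>
      (\<forall>u v. u \<noteq> v \<longrightarrow>
        (AE w in lebesgue. integrable lebesgue (basic_integrand \<alpha> \<rho> phi psi chi u v w)) \<and>
        integrable lebesgue (\<lambda>w. basic_fun \<alpha> \<rho> phi psi chi u v w) \<and>
        (LINT w|lebesgue. norm (basic_fun \<alpha> \<rho> phi psi chi u v w))
          \<le> inverse (adm_const phi) * C p \<rho> * \<bar>u - v\<bar> powr (- \<rho>)
              * Lp_norm 1 psi * Lp_norm p phi * Lp_norm q chi)"
    by (intro exI[of _ ?C] allI impI, elim conjE, rule *)
next
  have *: "(AE w in lebesgue. integrable lebesgue (basic_integrand \<alpha> \<rho> phi psi chi u v w)) \<and>
        integrable lebesgue (\<lambda>w. basic_fun \<alpha> \<rho> phi psi chi u v w) \<and>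
        (LINT w|lebesgue. norm (basic_fun \<alpha> \<rho> phi psi chi u v w))
          \<le> inverse (adm_const phi) * 2 powr (\<rho> - 1) * \<bar>u - v\<bar> powr (- \<rho>)
              * (Lp_norm 1 (\<lambda>x. phi x * complex_of_real (\<bar>x\<bar> powr (\<rho> - 1))) * Lp_norm 1 chi
                 + Lp_norm 1 (\<lambda>y. chi y * complex_of_real (\<bar>y\<bar> powr (\<rho> - 1))) * Lp_norm 1 phi)
              * Lp_norm 1 psi"
    if \<rho>: "1 \<le> \<rho>" and psi: "in_Lp 1 psi"
      and wphi: "in_Lp 1 (\<lambda>y. complex_of_real (1 + \<bar>y\<bar> powr (\<rho> - 1)) * phi y)"
      and wchi: "in_Lp 1 (\<lambda>y. complex_of_real (1 + \<bar>y\<bar> powr (\<rho> - 1)) * chi y)" and uv: "u \<noteq> v"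
    for \<alpha> \<rho> :: real and phi psi chi u v
  proof -
    note phi = in_Lp_1_weighted[OF wphi] and chi = in_Lp_1_weighted[OF wchi]
    obtain phi' where phi': "phi' \<in> borel_measurable borel" "AE x in lborel. phi x = phi' x"
      using phi ex_borel_AE_eq by (auto simp: in_Lp_def)
    obtain psi' where psi': "psi' \<in> borel_measurable borel" "AE x in lborel. psi x = psi' x"
      using psi ex_borel_AE_eq by (auto simp: in_Lp_def)
    obtain chi' where chi': "chi' \<in> borel_measurable borel" "AE x in lborel. chi x = chi' x"
      using chi ex_borel_AE_eq by (auto simp: in_Lp_def)
    note [measurable] = phi'(1) psi'(1) chi'(1)
    let ?w = "\<lambda>f x. f x * complex_of_real (\<bar>x\<bar> powr (\<rho> - 1))"
    let ?K = "2 powr (\<rho> - 1) * (Lp_norm 1 (?w phi) * Lp_norm 1 chi + Lp_norm 1 (?w chi) * Lp_norm 1 phi)"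
    have weighted: "(\<integral>\<^sup>+x. ennreal (norm (f' x) * \<bar>x\<bar> powr (\<rho> - 1)) \<partial>lborel) = ennreal (Lp_norm 1 (?w f))"
      if [measurable]: "f' \<in> borel_measurable borel" and ae: "AE x in lborel. f x = f' x" and f: "in_Lp 1 (?w f)"
      for f f'
    proof -
      \<comment> \<open>The weighted Borel representative represents the weighted function, so the
        norm identity applies with exponent 1.\<close>
      have "AE x in lborel. ?w f x = ?w f' x" using ae by eventually_elim simp
      moreover have "?w f' \<in> borel_measurable borel" by measurable
      ultimately show ?thesis
        using nn_integral_Lp_norm[OF f, of "?w f'"] by (simp add: norm_mult)
    qed
    have S: "(\<integral>\<^sup>+x. ennreal (norm (psi' x)) \<partial>lborel) = ennreal (Lp_norm 1 psi)"
      using nn_integral_Lp_norm[OF psi _ psi'(2,1)] by simp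
    have L1: "(\<integral>\<^sup>+x. ennreal (norm (phi' x)) \<partial>lborel) = ennreal (Lp_norm 1 phi)"
        "(\<integral>\<^sup>+x. ennreal (norm (chi' x)) \<partial>lborel) = ennreal (Lp_norm 1 chi)"
      using nn_integral_Lp_norm[OF phi(1) _ phi'(2,1)] nn_integral_Lp_norm[OF chi(1) _ chi'(2,1)] by simp_all
    have K: "(\<integral>\<^sup>+y. \<integral>\<^sup>+s. ennreal (norm (chi' y) * norm (phi' (y + s)) * \<bar>s\<bar> powr (\<rho> - 1)) \<partial>lborel \<partial>lborel)
        \<le> ennreal ?K"
    proof -
      have "ennreal ?K = ennreal (2 powr (\<rho> - 1)) * (ennreal (Lp_norm 1 (?w phi)) * ennreal (Lp_norm 1 chi)
          + ennreal (Lp_norm 1 (?w chi)) * ennreal (Lp_norm 1 phi))"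
        by (simp add: ennreal_mult)
      then show ?thesis
        using nn_integral_weighted_L1_bound[OF _ _ norm_ge_zero norm_ge_zero \<rho>, of phi' chi']
        unfolding L1 weighted[OF phi' phi(2)] weighted[OF chi' chi(2)] by simp
    qed
    have "0 \<le> ?K" by simp
    note bf = basic_fun_bound[OF phi'(2,1) psi'(2,1) chi'(2,1) uv S Lp_norm_nonneg K this, of \<alpha>]
    show ?thesis using bf by (simp add: mult_ac)
  qed
  show "\<forall>(\<alpha>::real) (\<rho>::real) phi psi chi.
      sin (\<alpha> * pi / 2) \<noteq> 0 \<and> admissible phi \<and> \<rho> \<ge> 1 \<and>
      in_Lp 1 psi \<and>
      in_Lp 1 (\<lambda>y. complex_of_real (1 + \<bar>y\<bar> powr (\<rho> - 1)) * phi y) \<and>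
      in_Lp 1 (\<lambda>y. complex_of_real (1 + \<bar>y\<bar> powr (\<rho> - 1)) * chi y) \<longrightarrow>
      (\<forall>u v. u \<noteq> v \<longrightarrow>
        (AE w in lebesgue. integrable lebesgue (basic_integrand \<alpha> \<rho> phi psi chi u v w)) \<and>
        integrable lebesgue (\<lambda>w. basic_fun \<alpha> \<rho> phi psi chi u v w) \<and>
        (LINT w|lebesgue. norm (basic_fun \<alpha> \<rho> phi psi chi u v w))
          \<le> inverse (adm_const phi) * 2 powr (\<rho> - 1) * \<bar>u - v\<bar> powr (- \<rho>)
              * (Lp_norm 1 (\<lambda>x. phi x * complex_of_real (\<bar>x\<bar> powr (\<rho> - 1))) * Lp_norm 1 chi
                 + Lp_norm 1 (\<lambda>y. chi y * complex_of_real (\<bar>y\<bar> powr (\<rho> - 1))) * Lp_norm 1 phi)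
              * Lp_norm 1 psi)"
    by (intro allI impI, elim conjE, rule *)
qed

end
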